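(* Suppose that a metric space is presented as a union $A\cup B$ of two subspaces. Then $$\operatorname{asdim}(A\cup B)\le\max\{\operatorname{asdim}A,\operatorname{asdim}B\}.$$
   Context: Subsets of a metric space carry the restricted metric. Two sets $U_1,U_2$ in a metric space are $d$-disjoint if $\inf\{\operatorname{dist}(x_1,x_2)\mid x_1\in U_1,\ x_2\in U_2\}\ge d$; a family of sets is $d$-disjoint if any two distinct members are $d$-disjoint, and uniformly bounded if the diameters of its members are bounded by a common constant. A metric space $X$ satisfies $\operatorname{asdim}X\le n$ if for every (arbitrarily large) $d>0$ there are $n+1$ uniformly bounded $d$-disjoint families $\mathcal U^0,\dots,\mathcal U^n$ of subsets of $X$ such that $\bigcup_i\mathcal U^i$ covers $X$. $\operatorname{asdim}X$ is the least such $n$ (and $\infty$ if there is none). *)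

theory Defs
  imports "HOL-Analysis.Analysis"
begin

text \<open>A (sub)space is a set in an ambient type of class \<open>metric_space\<close>, with the
  restricted metric.\<close>

text \<open>The infimum is taken in \<^typ>\<open>ereal\<close>, so that the infimum over the empty set is infinite and
  the empty set is \<open>d\<close>-disjoint from every set. (For \<^const>\<open>setdist\<close>, and for
  the infimum of a set of reals, the empty case would give the wrong value.)\<close>

definition d_disjoint :: "real \<Rightarrow> 'a::metric_space set \<Rightarrow> 'a set \<Rightarrow> bool" where
  "d_disjoint d U1 U2 \<longleftrightarrow>
     Inf {ereal (dist x1 x2) | x1 x2. x1 \<in> U1 \<and> x2 \<in> U2} \<ge> ereal d"

definition d_disjoint_family :: "real \<Rightarrow> 'a::metric_space set set \<Rightarrow> bool" where
  "d_disjoint_family d \<U> \<longleftrightarrow>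
     (\<forall>U1\<in>\<U>. \<forall>U2\<in>\<U>. U1 \<noteq> U2 \<longrightarrow> d_disjoint d U1 U2)"

text \<open>The conjunct \<^term>\<open>bounded U\<close> is needed because \<^term>\<open>diameter U\<close> is an unspecified real
  number when \<open>U\<close> is unbounded.\<close>

definition uniformly_bounded :: "'a::metric_space set set \<Rightarrow> bool" where
  "uniformly_bounded \<U> \<longleftrightarrow> (\<exists>C. \<forall>U\<in>\<U>. bounded U \<and> diameter U \<le> C)"

definition asdim_le :: "'a::metric_space set \<Rightarrow> nat \<Rightarrow> bool" where
  "asdim_le X n \<longleftrightarrow>
     (\<forall>d>0. \<exists>\<U> :: nat \<Rightarrow> 'a set set.
        (\<forall>i\<le>n. (\<forall>U\<in>\<U> i. U \<subseteq> X) \<and> uniformly_bounded (\<U> i) \<and> d_disjoint_family d (\<U> i)) \<and>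
        X \<subseteq> \<Union> (\<Union>i\<le>n. \<U> i))"

text \<open>In \<^typ>\<open>enat\<close> the infimum of a nonempty set is its least element, and that of the empty
  set is \<open>\<infinity>\<close>.\<close>

definition asdim :: "'a::metric_space set \<Rightarrow> enat" where
  "asdim X = Inf {enat n | n. asdim_le X n}"

end

theory Submission
  imports Defs
begin

text \<open>
  Given \<open>d > 0\<close>, choose first \<open>d\<close>-disjoint families covering \<open>A\<close>, with diameters at most \<open>R\<close>, and
  only then families covering \<open>B\<close> that are \<open>(3 * d + 2 * R)\<close>-disjoint. Merge the two families of each
  colour into one: let each member \<open>V\<close> of the second family absorb all members \<open>U\<close> of the first
  that come closer to it than \<open>d\<close>, and keep the members of the first family that nothing absorbs.
  Absorption moves no point further than \<open>d + R\<close> away from \<open>V\<close>, so the enlarged sets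
  remain bounded, and two of them remain \<open>d\<close> apart because
  \<open>(3 * d + 2 * R) - 2 * (d + R) = d\<close>. A set that nothing absorbs is \<open>d\<close>-far from every \<open>V\<close>
  by the choice of what is absorbed, and \<open>d\<close>-far from every other \<open>U\<close> by hypothesis. No new colour is
  used, so \<open>n + 1\<close> families suffice for \<open>A \<union> B\<close> whenever they do for both \<open>A\<close> and \<open>B\<close>.
  The lemmas \<open>saturated_union_disjoint\<close> and \<open>saturated_union_bounded\<close> carry this construction.
\<close>

section \<open>Disjointness and boundedness in terms of distances\<close>

lemma d_disjoint_iff: "d_disjoint d U V \<longleftrightarrow> (\<forall>x\<in>U. \<forall>y\<in>V. d \<le> dist x y)"
proof -
  have "d_disjoint d U V \<longleftrightarrow> (\<forall>x\<in>U. \<forall>y\<in>V. ereal d \<le> ereal (dist x y))"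
    unfolding d_disjoint_def le_Inf_iff by blast
  then show ?thesis
    by simp
qed

lemma d_disjoint_family_dist:
  assumes "d_disjoint_family d \<U>" "U \<in> \<U>" "V \<in> \<U>" "U \<noteq> V" "x \<in> U" "y \<in> V"
  shows "d \<le> dist x y"
  using assms unfolding d_disjoint_family_def d_disjoint_iff by blast

lemma uniformly_bounded_iff:
  "uniformly_bounded \<U> \<longleftrightarrow> (\<exists>C. \<forall>U\<in>\<U>. \<forall>x\<in>U. \<forall>y\<in>U. dist x y \<le> C)"
proof
  assume "uniformly_bounded \<U>"
  then obtain C where "\<And>U. U \<in> \<U> \<Longrightarrow> bounded U \<and> diameter U \<le> C"
    unfolding uniformly_bounded_def by blast
  then show "\<exists>C. \<forall>U\<in>\<U>. \<forall>x\<in>U. \<forall>y\<in>U. dist x y \<le> C"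
    by (meson diameter_bounded_bound order_trans)
next
  assume "\<exists>C. \<forall>U\<in>\<U>. \<forall>x\<in>U. \<forall>y\<in>U. dist x y \<le> C"
  then obtain C where C: "\<And>U x y. U \<in> \<U> \<Longrightarrow> x \<in> U \<Longrightarrow> y \<in> U \<Longrightarrow> dist x y \<le> C"
    by blast
  \<comment> \<open>The empty set has diameter 0, and \<open>C\<close> may be negative if no other set is present.\<close>
  have "bounded U \<and> diameter U \<le> max C 0" if "U \<in> \<U>" for U
  proof
    show "bounded U"
      unfolding bounded_two_points using C that by blast
    show "diameter U \<le> max C 0"
      unfolding diameter_def using C[OF that] by (auto intro!: cSUP_least simp: le_max_iff_disj)
  qed
  then show "uniformly_bounded \<U>"
    unfolding uniformly_bounded_def by blast
qed

lemma uniformly_boundedE: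
  assumes "uniformly_bounded \<U>"
  obtains R where "R \<ge> 0" "\<forall>U\<in>\<U>. \<forall>x\<in>U. \<forall>y\<in>U. dist x y \<le> R"
proof -
  obtain C where C: "\<forall>U\<in>\<U>. \<forall>x\<in>U. \<forall>y\<in>U. dist x y \<le> C"
    using assms unfolding uniformly_bounded_iff ..
  show thesis
    by (rule that[of "max C 0"]) (use C in \<open>auto simp: le_max_iff_disj\<close>)
qed

text \<open>One bound has to serve all colours at once, since it determines how far apart the sets
  covering the second subspace are to be taken.\<close>

lemma uniformly_bounded_finitely_many:
  fixes \<U> :: "nat \<Rightarrow> 'a::metric_space set set"
  assumes "\<forall>i\<le>n. uniformly_bounded (\<U> i)"
  obtains R where "R \<ge> 0" "\<forall>i\<le>n. \<forall>U\<in>\<U> i. \<forall>x\<in>U. \<forall>y\<in>U. dist x y \<le> R"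
proof -
  have "\<forall>i. \<exists>C. i \<le> n \<longrightarrow> (\<forall>U\<in>\<U> i. \<forall>x\<in>U. \<forall>y\<in>U. dist x y \<le> C)"
    using assms unfolding uniformly_bounded_iff by blast
  then obtain C where C: "\<And>i U x y. \<lbrakk>i \<le> n; U \<in> \<U> i; x \<in> U; y \<in> U\<rbrakk> \<Longrightarrow> dist x y \<le> C i"
    by metis
  show thesis
  proof (rule that)
    show "0 \<le> (\<Sum>j\<le>n. \<bar>C j\<bar>)"
      by (simp add: sum_nonneg)
    show "\<forall>i\<le>n. \<forall>U\<in>\<U> i. \<forall>x\<in>U. \<forall>y\<in>U. dist x y \<le> (\<Sum>j\<le>n. \<bar>C j\<bar>)"
    proof (intro allI impI ballI)
      fix i U x y assume i: "i \<le> n" and "U \<in> \<U> i" "x \<in> U" "y \<in> U"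
      then have "dist x y \<le> C i"
        using C[OF i] by blast
      moreover have "\<bar>C i\<bar> \<le> (\<Sum>j\<le>n. \<bar>C j\<bar>)"
        using i by (intro member_le_sum) auto
      ultimately show "dist x y \<le> (\<Sum>j\<le>n. \<bar>C j\<bar>)"
        by linarith
    qed
  qed
qed

section \<open>The saturated union of two families\<close>

definition near :: "real \<Rightarrow> 'a::metric_space set \<Rightarrow> 'a set \<Rightarrow> bool" where
  "near d U V \<longleftrightarrow> (\<exists>u\<in>U. \<exists>v\<in>V. dist u v < d)"

definition saturate :: "real \<Rightarrow> 'a::metric_space set set \<Rightarrow> 'a set \<Rightarrow> 'a set" where
  "saturate d \<U> V = V \<union> \<Union>{U\<in>\<U>. near d U V}"

definition saturated_union ::
    "real \<Rightarrow> 'a::metric_space set set \<Rightarrow> 'a set set \<Rightarrow> 'a set set" where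
  "saturated_union d \<U> \<V> = saturate d \<U> ` \<V> \<union> {U\<in>\<U>. \<forall>V\<in>\<V>. \<not> near d U V}"

lemma saturated_unionE:
  assumes "S \<in> saturated_union d \<U> \<V>"
  obtains (absorbing) V where "V \<in> \<V>" "S = saturate d \<U> V"
    | (free) "S \<in> \<U>" "\<forall>V\<in>\<V>. \<not> near d S V"
  using assms unfolding saturated_union_def by blast

lemma Union_saturated_union: "\<Union>(saturated_union d \<U> \<V>) = \<Union>\<U> \<union> \<Union>\<V>"
  unfolding saturated_union_def saturate_def by blast

lemma saturate_close:
  assumes "x \<in> saturate d \<U> V" "d > 0" "R \<ge> 0"
    and bdd: "\<forall>U\<in>\<U>. \<forall>x\<in>U. \<forall>y\<in>U. dist x y \<le> R"
  obtains v where "v \<in> V" "dist x v \<le> d + R"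
proof (cases "x \<in> V")
  case True
  then show thesis
    using that[of x] assms by simp
next
  case False
  then obtain U u v where U: "U \<in> \<U>" "x \<in> U" "u \<in> U" and v: "v \<in> V" "dist u v < d"
    using assms(1) unfolding saturate_def near_def by blast
  have "dist x v \<le> dist x u + dist u v"
    by (rule dist_triangle)
  also have "\<dots> \<le> d + R"
    using bdd U v by fastforce
  finally show thesis
    using that v by blast
qed

text \<open>Besides two enlarged sets and two unabsorbed ones, an enlarged set \<open>V\<close> has to be compared with
  an unabsorbed \<open>W\<close>. The points of \<open>V\<close> itself are far from \<open>W\<close>, since otherwise \<open>V\<close> would have
  absorbed it; the points added to \<open>V\<close> lie in members of \<open>\<U>\<close> that were absorbed, hence differ
  from \<open>W\<close>, and disjointness of \<open>\<U>\<close> applies.\<close>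

lemma saturated_union_disjoint:
  assumes "d > 0" "R \<ge> 0"
    and bdd: "\<forall>U\<in>\<U>. \<forall>x\<in>U. \<forall>y\<in>U. dist x y \<le> R"
    and U: "d_disjoint_family d \<U>"
    and V: "d_disjoint_family (3 * d + 2 * R) \<V>"
  shows "d_disjoint_family d (saturated_union d \<U> \<V>)"
proof -
  have saturate_saturate: "d \<le> dist x y"
    if VW: "V \<in> \<V>" "W \<in> \<V>" "V \<noteq> W" and x: "x \<in> saturate d \<U> V" and y: "y \<in> saturate d \<U> W"
    for V W x y
  proof -
    obtain v where v: "v \<in> V" "dist x v \<le> d + R"
      using saturate_close[OF x assms(1-3)] .
    obtain w where w: "w \<in> W" "dist y w \<le> d + R"
      using saturate_close[OF y assms(1-3)] .
    have "3 * d + 2 * R \<le> dist v w"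
      using d_disjoint_family_dist[OF V VW v(1) w(1)] .
    also have "\<dots> \<le> dist x v + dist x y + dist y w"
      by metric
    finally show ?thesis
      using v w by linarith
  qed
  have saturate_free: "d \<le> dist x y"
    if V: "V \<in> \<V>" and "x \<in> saturate d \<U> V" and W: "W \<in> \<U>" "\<not> near d W V" "y \<in> W" for V W x y
    using that(2) unfolding saturate_def
  proof
    assume "x \<in> V"
    then show ?thesis
      using W unfolding near_def by (metis dist_commute not_less)
  next
    assume "x \<in> \<Union>{U\<in>\<U>. near d U V}"
    then obtain U' where U': "U' \<in> \<U>" "near d U' V" "x \<in> U'"
      by blast
    then have "U' \<noteq> W"
      using W(2) by blast
    then show ?thesis
      using d_disjoint_family_dist[OF U U'(1) W(1) _ U'(3) W(3)] by blast
  qed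
  have "d \<le> dist x y"
    if S: "S \<in> saturated_union d \<U> \<V>" and T: "T \<in> saturated_union d \<U> \<V>"
      and ne: "S \<noteq> T" and x: "x \<in> S" and y: "y \<in> T" for S T x y
    using S
  proof (cases rule: saturated_unionE)
    case S: (absorbing V)
    show ?thesis
      using T
    proof (cases rule: saturated_unionE)
      case T: (absorbing W)
      have "V \<noteq> W"
        using ne S T by blast
      then show ?thesis
        using saturate_saturate[OF S(1) T(1)] S(2) T(2) x y by simp
    next
      case free
      then show ?thesis
        using saturate_free[OF S(1), of x T y] S x y by simp
    qed
  next
    case S: free
    show ?thesis
      using T
    proof (cases rule: saturated_unionE)
      case T: (absorbing W)
      then show ?thesis
        using saturate_free[OF T(1), of y S x] S x y by (simp add: dist_commute)
    next
      case free
      then show ?thesis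
        using d_disjoint_family_dist[OF U S(1) _ ne x y] by simp
    qed
  qed
  then show ?thesis
    unfolding d_disjoint_family_def d_disjoint_iff by simp
qed

lemma saturated_union_bounded:
  assumes "d > 0" "uniformly_bounded \<U>" "uniformly_bounded \<V>"
  shows "uniformly_bounded (saturated_union d \<U> \<V>)"
proof -
  obtain R where R: "R \<ge> 0" "\<forall>U\<in>\<U>. \<forall>x\<in>U. \<forall>y\<in>U. dist x y \<le> R"
    using uniformly_boundedE[OF assms(2)] .
  obtain D where D: "D \<ge> 0" "\<forall>V\<in>\<V>. \<forall>x\<in>V. \<forall>y\<in>V. dist x y \<le> D"
    using uniformly_boundedE[OF assms(3)] .
  have "dist x y \<le> (d + R) + D + (d + R)"
    if S: "S \<in> saturated_union d \<U> \<V>" and xy: "x \<in> S" "y \<in> S" for S x y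
    using S
  proof (cases rule: saturated_unionE)
    case (absorbing V)
    then have V: "V \<in> \<V>" "x \<in> saturate d \<U> V" "y \<in> saturate d \<U> V"
      using xy by simp_all
    obtain v where v: "v \<in> V" "dist x v \<le> d + R"
      using saturate_close[OF V(2) assms(1) R] .
    obtain w where w: "w \<in> V" "dist y w \<le> d + R"
      using saturate_close[OF V(3) assms(1) R] .
    have "dist v w \<le> D"
      using D(2) V(1) v(1) w(1) by blast
    have "dist x y \<le> dist x v + dist v w + dist y w"
      by metric
    also have "\<dots> \<le> (d + R) + D + (d + R)"
      by (intro add_mono v w \<open>dist v w \<le> D\<close>)
    finally show ?thesis .
  next
    case free
    then have "dist x y \<le> R"
      using R(2) xy by blast
    then show ?thesis
      using R(1) D(1) \<open>d > 0\<close> by linarith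
  qed
  then show ?thesis
    unfolding uniformly_bounded_iff by (intro exI[of _ "(d + R) + D + (d + R)"]) simp
qed

section \<open>Asymptotic dimension of a union\<close>

lemma asdim_le_Un:
  assumes A: "asdim_le A n" and B: "asdim_le B n"
  shows "asdim_le (A \<union> B) n"
  unfolding asdim_le_def
proof (intro allI impI)
  fix d :: real
  assume d: "d > 0"
  obtain \<U> where "\<forall>i\<le>n. (\<forall>U\<in>\<U> i. U \<subseteq> A) \<and> uniformly_bounded (\<U> i) \<and> d_disjoint_family d (\<U> i)"
      "A \<subseteq> \<Union>(\<Union>i\<le>n. \<U> i)"
    using A[unfolded asdim_le_def, rule_format, OF d] by (elim exE conjE)
  then have U: "\<And>i U. i \<le> n \<Longrightarrow> U \<in> \<U> i \<Longrightarrow> U \<subseteq> A" "\<And>i. i \<le> n \<Longrightarrow> uniformly_bounded (\<U> i)"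
      "\<And>i. i \<le> n \<Longrightarrow> d_disjoint_family d (\<U> i)" "A \<subseteq> \<Union>(\<Union>i\<le>n. \<U> i)"
    by simp_all
  have "\<forall>i\<le>n. uniformly_bounded (\<U> i)"
    using U(2) by simp
  then obtain R where R: "R \<ge> 0"
      "\<forall>i\<le>n. \<forall>U\<in>\<U> i. \<forall>x\<in>U. \<forall>y\<in>U. dist x y \<le> R"
    by (rule uniformly_bounded_finitely_many)
  have s: "3 * d + 2 * R > 0"
    using d R(1) by linarith
  obtain \<V> where "\<forall>i\<le>n. (\<forall>V\<in>\<V> i. V \<subseteq> B) \<and> uniformly_bounded (\<V> i) \<and>
      d_disjoint_family (3 * d + 2 * R) (\<V> i)" "B \<subseteq> \<Union>(\<Union>i\<le>n. \<V> i)"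
    using B[unfolded asdim_le_def, rule_format, OF s] by (elim exE conjE)
  then have V: "\<And>i V. i \<le> n \<Longrightarrow> V \<in> \<V> i \<Longrightarrow> V \<subseteq> B"
      "\<And>i. i \<le> n \<Longrightarrow> uniformly_bounded (\<V> i)"
      "\<And>i. i \<le> n \<Longrightarrow> d_disjoint_family (3 * d + 2 * R) (\<V> i)" "B \<subseteq> \<Union>(\<Union>i\<le>n. \<V> i)"
    by simp_all
  define W where "W i = saturated_union d (\<U> i) (\<V> i)" for i
  have "S \<subseteq> A \<union> B" if "i \<le> n" "S \<in> W i" for i S
    using Union_saturated_union[of d "\<U> i" "\<V> i"] U(1)[OF that(1)] V(1)[OF that(1)] that(2)
    unfolding W_def by blast
  moreover have "uniformly_bounded (W i)" if "i \<le> n" for i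
    unfolding W_def using saturated_union_bounded[OF d U(2)[OF that] V(2)[OF that]] .
  moreover have "d_disjoint_family d (W i)" if "i \<le> n" for i
    unfolding W_def using saturated_union_disjoint[OF d R(1) R(2)[THEN spec, THEN mp, OF that]
        U(3)[OF that] V(3)[OF that]] .
  moreover have "A \<union> B \<subseteq> \<Union>(\<Union>i\<le>n. W i)"
  proof -
    have "\<Union>(\<Union>i\<le>n. W i) = (\<Union>i\<le>n. \<Union>(W i))"
      by blast
    also have "\<dots> = \<Union>(\<Union>i\<le>n. \<U> i) \<union> \<Union>(\<Union>i\<le>n. \<V> i)"
      unfolding W_def Union_saturated_union by blast
    finally show ?thesis
      using Un_mono[OF U(4) V(4)] by (simp only:)
  qed
  ultimately have "(\<forall>i\<le>n. (\<forall>S\<in>W i. S \<subseteq> A \<union> B) \<and> uniformly_bounded (W i) \<and> d_disjoint_family d (W i)) \<and>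
      A \<union> B \<subseteq> \<Union>(\<Union>i\<le>n. W i)"
    by simp
  then show "\<exists>\<W> :: nat \<Rightarrow> 'a set set.
      (\<forall>i\<le>n. (\<forall>W\<in>\<W> i. W \<subseteq> A \<union> B) \<and> uniformly_bounded (\<W> i) \<and> d_disjoint_family d (\<W> i)) \<and>
      A \<union> B \<subseteq> \<Union>(\<Union>i\<le>n. \<W> i)"
    by (rule exI[of _ W])
qed

text \<open>Empty families serve as the additional colours. This is what allows the same number of
  colours to be used for two subspaces of different asymptotic dimension.\<close>

lemma asdim_le_mono:
  assumes "asdim_le X m" "m \<le> n"
  shows "asdim_le X n"
  unfolding asdim_le_def
proof (intro allI impI)
  fix d :: real
  assume d: "d > 0"
  obtain \<U> where U: "\<forall>i\<le>m. (\<forall>U\<in>\<U> i. U \<subseteq> X) \<and> uniformly_bounded (\<U> i) \<and> d_disjoint_family d (\<U> i)"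
      "X \<subseteq> \<Union>(\<Union>i\<le>m. \<U> i)"
    using assms(1)[unfolded asdim_le_def, rule_format, OF d] by (elim exE conjE)
  define V where "V i = (if i \<le> m then \<U> i else {})" for i
  have "\<forall>i\<le>n. (\<forall>S\<in>V i. S \<subseteq> X) \<and> uniformly_bounded (V i) \<and> d_disjoint_family d (V i)"
    unfolding V_def using U(1) by (auto simp: uniformly_bounded_def d_disjoint_family_def)
  moreover have "X \<subseteq> \<Union>(\<Union>i\<le>n. V i)"
  proof
    fix x assume "x \<in> X"
    then obtain i U where "i \<le> m" "U \<in> \<U> i" "x \<in> U"
      using U(2) by blast
    then show "x \<in> \<Union>(\<Union>i\<le>n. V i)"
      unfolding V_def using assms(2) by (auto intro!: bexI[of _ i])
  qed
  ultimately have "(\<forall>i\<le>n. (\<forall>S\<in>V i. S \<subseteq> X) \<and> uniformly_bounded (V i) \<and> d_disjoint_family d (V i)) \<and>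
      X \<subseteq> \<Union>(\<Union>i\<le>n. V i)"
    by (rule conjI)
  then show "\<exists>\<V> :: nat \<Rightarrow> 'a set set.
      (\<forall>i\<le>n. (\<forall>V\<in>\<V> i. V \<subseteq> X) \<and> uniformly_bounded (\<V> i) \<and> d_disjoint_family d (\<V> i)) \<and>
      X \<subseteq> \<Union>(\<Union>i\<le>n. \<V> i)"
    by (rule exI[of _ V])
qed

lemma asdim_le_enat_iff: "asdim X \<le> enat n \<longleftrightarrow> asdim_le X n"
proof
  assume le: "asdim X \<le> enat n"
  have "{enat n | n. asdim_le X n} \<noteq> {}"
    using le unfolding asdim_def Inf_enat_def by (auto split: if_splits)
  then have "asdim X \<in> {enat n | n. asdim_le X n}"
    unfolding asdim_def by (meson ex_in_conv wellorder_InfI)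
  then show "asdim_le X n"
    using le asdim_le_mono by auto
next
  assume "asdim_le X n"
  then show "asdim X \<le> enat n"
    unfolding asdim_def by (auto intro: Inf_lower)
qed

theorem mainTheorem2:
  fixes A B :: "'a::metric_space set"
  shows "asdim (A \<union> B) \<le> max (asdim A) (asdim B)"
proof (cases "max (asdim A) (asdim B)")
  case (enat n)
  then have "asdim A \<le> enat n" "asdim B \<le> enat n"
    by (metis max.cobounded1, metis max.cobounded2)
  then show ?thesis
    unfolding enat asdim_le_enat_iff by (rule asdim_le_Un)
next
  case infinity
  then show ?thesis
    by simp
qed

end
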